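(* For $n\geq 1$ let $\mathcal{H}_n$ be the set of all functions $h\colon\mathbb{N}\to\mathbb{N}$ of the form $h=h_F$ for some final segment $F$ of $\mathbb{N}^n$ (with the product ordering), where $h_F(a)$ is the number of $\nu=(\nu_1,\dots,\nu_n)\in\mathbb{N}^n\setminus F$ with $\nu_1+\cdots+\nu_n=a$. Let $\mathcal{H}:=\bigcup_{n\geq 1}\mathcal{H}_n$, ordered by $h\leq h'$ if and only if $h(a)\leq h'(a)$ for all $a\in\mathbb{N}$. Then $\mathcal{H}$ is Nash-Williams.
   Context: $\mathbb{N}=\{0,1,2,\dots\}$. A final segment of an ordered set is an upward closed subset. Finite or infinite subsets of $\mathbb{N}$ are identified with strictly increasing sequences; $s\preceq t$ means that $s$ is an initial segment of $t$. For non-empty finite $s,t\subseteq\mathbb{N}$ write $s\vartriangleleft t$ if $\min s<\min t$ and $s\setminus\{\min s\}\preceq t\setminus\{\max t\}$. For an infinite set $X\subseteq\mathbb{N}$, a barrier with base $X$ is a set $B$ of non-empty finite subsets of $X$ such that every infinite subset of $X$ has an initial segment in $B$, and no element of $B$ is a proper subset of another element of $B$. An ordered set $S$ is Nash-Williams if for every barrier $B$ and every function $f\colon B\to S$ there are $b_1,b_2\in B$ with $b_1\vartriangleleft b_2$ and $f(b_1)\leq f(b_2)$. *)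

theory Defs
  imports Main "HOL-Library.FuncSet"
begin

text \<open>
  Subsets of the naturals, finite or infinite, stand for the strictly increasing sequences that
  enumerate them. In these terms, \<open>s\<close> is an initial segment of \<open>t\<close> iff \<open>s\<close> is contained in \<open>t\<close>
  and contains every element of \<open>t\<close> that lies below an element of \<open>s\<close>.
\<close>
definition initial_segment :: "nat set \<Rightarrow> nat set \<Rightarrow> bool" where
  "initial_segment s t \<longleftrightarrow> s \<subseteq> t \<and> (\<forall>x\<in>t. \<forall>y\<in>s. x < y \<longrightarrow> x \<in> s)"

definition shift_rel :: "nat set \<Rightarrow> nat set \<Rightarrow> bool" where
  "shift_rel s t \<longleftrightarrow>
     finite s \<and> s \<noteq> {} \<and> finite t \<and> t \<noteq> {} \<and>
     Min s < Min t \<and> initial_segment (s - {Min s}) (t - {Max t})"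

definition barrier_on :: "nat set \<Rightarrow> nat set set \<Rightarrow> bool" where
  "barrier_on X B \<longleftrightarrow>
     infinite X \<and>
     (\<forall>b\<in>B. finite b \<and> b \<noteq> {} \<and> b \<subseteq> X) \<and>
     (\<forall>Y. Y \<subseteq> X \<and> infinite Y \<longrightarrow> (\<exists>b\<in>B. initial_segment b Y)) \<and>
     (\<forall>b\<in>B. \<forall>b'\<in>B. \<not> b \<subset> b')"

definition barrier :: "nat set set \<Rightarrow> bool" where
  "barrier B \<longleftrightarrow> (\<exists>X. barrier_on X B)"

text \<open>The set \<open>S\<close> carries the ordering inherited from its type.\<close>
definition nash_williams :: "'a::order set \<Rightarrow> bool" where
  "nash_williams S \<longleftrightarrow>
     (\<forall>B. barrier B \<longrightarrow>
        (\<forall>f \<in> B \<rightarrow> S. \<exists>b\<^sub>1\<in>B. \<exists>b\<^sub>2\<in>B. shift_rel b\<^sub>1 b\<^sub>2 \<and> f b\<^sub>1 \<le> f b\<^sub>2))"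

text \<open>The \<open>n\<close>-tuples of naturals are the lists of length \<open>n\<close>; their product ordering is
  \<^term>\<open>list_all2 (\<le>)\<close> (the list type itself carries no such ordering).\<close>
definition tuples :: "nat \<Rightarrow> nat list set" where
  "tuples n = {\<nu>. length \<nu> = n}"

definition final_segment :: "nat \<Rightarrow> nat list set \<Rightarrow> bool" where
  "final_segment n F \<longleftrightarrow>
     F \<subseteq> tuples n \<and> (\<forall>\<nu>\<in>F. \<forall>\<mu>\<in>tuples n. list_all2 (\<le>) \<nu> \<mu> \<longrightarrow> \<mu> \<in> F)"

definition hilb :: "nat \<Rightarrow> nat list set \<Rightarrow> nat \<Rightarrow> nat" where
  "hilb n F a = card {\<nu> \<in> tuples n - F. sum_list \<nu> = a}"

definition Hilb_dim :: "nat \<Rightarrow> (nat \<Rightarrow> nat) set" where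
  "Hilb_dim n = {h. \<exists>F. final_segment n F \<and> h = hilb n F}"

text \<open>The ordering on functions in the library (\<open>le_fun_def\<close>) is the pointwise one.\<close>
definition Hilb :: "(nat \<Rightarrow> nat) set" where
  "Hilb = (\<Union>n\<in>{1..}. Hilb_dim n)"

end

theory Submission
  imports Defs "HOL-Computational_Algebra.Primes" "HOL-Library.Infinite_Set"
begin

text \<open>
  A monomial is written as the multiset of the indices of its variables, and a final segment of
  \<open>\<nat>\<^sup>n\<close> is replaced by its complement, a down-closed set of multisets over \<open>{..<n}\<close>. This
  forgets \<open>n\<close>: an inclusion between two such sets, whatever their numbers of variables, gives the
  pointwise inequality of the functions that count their members by degree. Inclusion between
  arbitrary down-closed sets is too rare for different \<open>n\<close>, so the idea is to choose good
  representatives. By \<open>stable_representative\<close>, every Hilbert function is that of a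
  down-closed set that is also stable: it remains closed when a variable is replaced by its
  predecessor (its complement is a strongly stable monomial ideal). It is the lexicographically
  greatest down-closed set with the given Hilbert function, which exists by compactness, and
  compressing along two neighbouring variables shows that it is stable.

  Membership in such a set is inherited by every multiset \<open>M\<close> that is dominated by a member
  \<open>M'\<close>, in the sense that for each \<open>x\<close> at most as many elements of \<open>M\<close> as of \<open>M'\<close> are \<open>\<ge> x\<close>
  (\<open>stable_dominated\<close>). This order is containment of Young diagrams, that is, of certain down-closed
  subsets of \<open>\<nat> \<times> \<nat>\<close>. So two passages from an order to its down-closed sets lead from the stable
  sets to \<open>\<nat> \<times> \<nat>\<close>, and each of them is undone by picking an element of a set difference: a bad
  map into the stable sets yields a bad map into the Young diagrams, and this one yields a bad map
  into \<open>\<nat> \<times> \<nat>\<close> (\<open>locally_constant_stable_good\<close>).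

  Such choices are painless if a map on a barrier with base \<open>X\<close> is viewed as a locally constant
  map on the infinite subsets \<open>Y\<close> of \<open>X\<close>, taking at \<open>Y\<close> its value at the initial segment of \<open>Y\<close>
  in the barrier; the relation \<open>shift_rel\<close> then arises from passing from \<open>Y\<close> to \<open>Y\<close> without its
  least element (\<open>shift_rel_barrier_segment\<close>), and no new barriers have to be built. For \<open>\<nat> \<times> \<nat>\<close>,
  Ramsey's theorem for locally constant colourings (\<open>ramsey_locally_constant\<close>) makes the
  first coordinate never descend, and the second one cannot descend forever
  (\<open>locally_constant_nat_pair_good\<close>).
\<close>

section \<open>Locally constant functions of infinite sets of naturals\<close>

text \<open>
  Continuity into a discrete space, for the topology on the infinite subsets of \<open>X\<close> whose basic
  open sets consist of the sets with a prescribed part below a bound.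
\<close>
definition locally_constant_on :: "nat set \<Rightarrow> (nat set \<Rightarrow> 'a) \<Rightarrow> bool" where
  "locally_constant_on X f \<longleftrightarrow>
     (\<forall>Y\<subseteq>X. infinite Y \<longrightarrow>
        (\<exists>m. \<forall>Z\<subseteq>X. infinite Z \<and> Z \<inter> {..m} = Y \<inter> {..m} \<longrightarrow> f Z = f Y))"

definition drop_least :: "nat set \<Rightarrow> nat set" where
  "drop_least Y = Y - {Inf Y}"

lemma infinite_drop_least: "infinite Y \<Longrightarrow> infinite (drop_least Y)"
  by (simp add: drop_least_def)

lemma drop_least_subset: "drop_least Y \<subseteq> Y"
  by (auto simp: drop_least_def)

lemma Inf_mem_infinite: "infinite (Y :: nat set) \<Longrightarrow> Inf Y \<in> Y"
  by (rule Inf_nat_def1) auto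

lemma Inf_less_drop_least: "x \<in> drop_least Y \<Longrightarrow> Inf Y < x"
  by (simp add: drop_least_def) (metis cInf_lower bdd_below_bot le_neq_implies_less)

lemma locally_constant_on_compose:
  "locally_constant_on X f \<Longrightarrow> locally_constant_on X (\<lambda>Y. g (f Y))"
  unfolding locally_constant_on_def by metis

lemma locally_constant_onD:
  "locally_constant_on X f \<Longrightarrow> Y \<subseteq> X \<Longrightarrow> infinite Y \<Longrightarrow>
     \<exists>m. \<forall>Z\<subseteq>X. infinite Z \<and> Z \<inter> {..m} = Y \<inter> {..m} \<longrightarrow> f Z = f Y"
  by (simp add: locally_constant_on_def)

lemma locally_constant_on_Pair:
  assumes "locally_constant_on X f" "locally_constant_on X g"
  shows "locally_constant_on X (\<lambda>Y. (f Y, g Y))"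
  unfolding locally_constant_on_def
proof (intro allI impI)
  fix Y assume Y: "Y \<subseteq> X" "infinite Y"
  obtain m where m: "\<forall>Z\<subseteq>X. infinite Z \<and> Z \<inter> {..m} = Y \<inter> {..m} \<longrightarrow> f Z = f Y"
    using locally_constant_onD[OF assms(1) Y] by blast
  obtain k where k: "\<forall>Z\<subseteq>X. infinite Z \<and> Z \<inter> {..k} = Y \<inter> {..k} \<longrightarrow> g Z = g Y"
    using locally_constant_onD[OF assms(2) Y] by blast
  have "(f Z, g Z) = (f Y, g Y)"
    if Z: "Z \<subseteq> X" "infinite Z" "Z \<inter> {..max m k} = Y \<inter> {..max m k}" for Z
  proof -
    have "x \<in> Z \<longleftrightarrow> x \<in> Y" if "x \<le> max m k" for x
      using Z(3) that by (auto simp: set_eq_iff)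
    then have "Z \<inter> {..m} = Y \<inter> {..m}" "Z \<inter> {..k} = Y \<inter> {..k}"
      by auto
    then show ?thesis using m k Z(1,2) by simp
  qed
  then show "\<exists>m. \<forall>Z\<subseteq>X. infinite Z \<and> Z \<inter> {..m} = Y \<inter> {..m} \<longrightarrow> (f Z, g Z) = (f Y, g Y)"
    by blast
qed

text \<open>
  The value at \<open>Y\<close> without its least element is fixed by a finite part of \<open>Y\<close>, provided that this
  part is long enough to contain \<open>Inf Y\<close>: otherwise a nearby set could lose a different element.
\<close>
lemma locally_constant_on_drop_least:
  assumes "locally_constant_on X f"
  shows "locally_constant_on X (\<lambda>Y. f (drop_least Y))"
  unfolding locally_constant_on_def
proof (intro allI impI)
  fix Y assume Y: "Y \<subseteq> X" "infinite Y"
  then have "drop_least Y \<subseteq> X" "infinite (drop_least Y)"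
    using drop_least_subset[of Y] infinite_drop_least[of Y] by blast+
  then obtain m where m: "\<forall>Z\<subseteq>X. infinite Z \<and>
      Z \<inter> {..m} = drop_least Y \<inter> {..m} \<longrightarrow> f Z = f (drop_least Y)"
    using locally_constant_onD[OF assms] by blast
  define k where "k = max m (Inf Y)"
  have "f (drop_least Z) = f (drop_least Y)"
    if Z: "Z \<subseteq> X" "infinite Z" "Z \<inter> {..k} = Y \<inter> {..k}" for Z
  proof -
    have agree: "x \<in> Z \<longleftrightarrow> x \<in> Y" if "x \<le> k" for x
      using Z(3) that by (auto simp: set_eq_iff)
    have "Inf Y \<in> Z"
      using Inf_mem_infinite[OF Y(2)] agree by (simp add: k_def)
    then have "Inf Z \<le> Inf Y" by (simp add: cInf_lower)
    moreover from this have "Inf Z \<in> Y"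
      using Inf_mem_infinite[OF Z(2)] agree by (simp add: k_def)
    then have "Inf Y \<le> Inf Z" by (simp add: cInf_lower)
    ultimately have "Inf Z = Inf Y" by simp
    then have "drop_least Z \<inter> {..m} = drop_least Y \<inter> {..m}"
      using agree by (auto simp: drop_least_def k_def)
    then show ?thesis
      using m Z(1,2) drop_least_subset[of Z] infinite_drop_least[of Z] by (simp add: order_trans)
  qed
  then show "\<exists>m. \<forall>Z\<subseteq>X. infinite Z \<and> Z \<inter> {..m} = Y \<inter> {..m} \<longrightarrow>
      f (drop_least Z) = f (drop_least Y)"
    by blast
qed

section \<open>Ramsey's theorem for locally constant colourings\<close>

definition homogeneous :: "(nat set \<Rightarrow> bool) \<Rightarrow> nat set \<Rightarrow> bool" where
  "homogeneous c W \<longleftrightarrow>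
     (\<forall>Y\<subseteq>W. infinite Y \<longrightarrow> c Y) \<or> (\<forall>Y\<subseteq>W. infinite Y \<longrightarrow> \<not> c Y)"

definition ramsey_in :: "nat set \<Rightarrow> (nat set \<Rightarrow> bool) \<Rightarrow> bool" where
  "ramsey_in X c \<longleftrightarrow>
     (\<forall>Z\<subseteq>X. infinite Z \<longrightarrow> (\<exists>W\<subseteq>Z. infinite W \<and> homogeneous c W))"

text \<open>
  A diagonal argument: choose \<open>n\<^sub>0 < n\<^sub>1 < \<dots>\<close> and \<open>V\<^sub>0 \<supseteq> V\<^sub>1 \<supseteq> \<dots>\<close> such that all later \<open>n\<^sub>l\<close> lie in
  \<open>V\<^sub>k\<close> and \<open>V\<^sub>k\<close> is homogeneous for the colouring derived at \<open>n\<^sub>k\<close>. The colour of a set of \<open>n\<^sub>k\<close>'s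
  then depends only on its least element, and one of the two colours occurs infinitely often.
  Only large \<open>n\<close> are required to have Ramsey derivatives, so that when this lemma is used in
  contrapositive form, a bad \<open>n\<close> can be chosen above any bound.
\<close>
lemma ramsey_in_if_derived_ramsey:
  assumes derived: "\<And>n. n \<in> X \<Longrightarrow> m < n \<Longrightarrow> ramsey_in X (\<lambda>Y. c (insert n Y))"
  shows "ramsey_in X c"
  unfolding ramsey_in_def
proof (intro allI impI)
  fix Z assume Z: "Z \<subseteq> X" "infinite Z"
  define good where "good = (\<lambda>(n, V). n \<in> Z \<and> V \<subseteq> Z \<and> infinite V \<and> (\<forall>v\<in>V. n < v) \<and>
      homogeneous (\<lambda>Y. c (insert n Y)) V)"
  have extend: "\<exists>n V. good (n, V) \<and> n \<in> U \<and> V \<subseteq> U"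
    if U: "U \<subseteq> Z" "infinite U" for U
  proof -
    obtain n where n: "n \<in> U" "m < n"
      using U(2) by (metis infinite_nat_iff_unbounded)
    have "infinite (U \<inter> {n<..})"
      using U(2) by (metis finite_atMost Compl_atMost Diff_eq Diff_infinite_finite)
    then obtain V where "V \<subseteq> U \<inter> {n<..}" "infinite V" "homogeneous (\<lambda>Y. c (insert n Y)) V"
      using derived[of n] n U Z unfolding ramsey_in_def
      by (metis inf.coboundedI1 order_trans subsetD)
    then show ?thesis
      using n U unfolding good_def by (intro exI[of _ n] exI[of _ V]) auto
  qed
  obtain F where F: "\<And>k. good (F k)"
      "\<And>k. fst (F (Suc k)) \<in> snd (F k) \<and> snd (F (Suc k)) \<subseteq> snd (F k)"
  proof -
    have "\<exists>F. \<forall>k. good (F k) \<and>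
      fst (F (Suc k)) \<in> snd (F k) \<and> snd (F (Suc k)) \<subseteq> snd (F k)"
    proof (rule dependent_nat_choice[where P = "\<lambda>_. good" and
          Q = "\<lambda>_ x y. fst y \<in> snd x \<and> snd y \<subseteq> snd x"])
      show "\<exists>x. good x"
        using extend[of Z] Z by blast
      show "\<exists>y. good y \<and> fst y \<in> snd x \<and> snd y \<subseteq> snd x" if "good x" for x and k :: nat
      proof -
        have "snd x \<subseteq> Z" "infinite (snd x)"
          using that by (auto simp: good_def split: prod.splits)
        then obtain n V where "good (n, V)" "n \<in> snd x" "V \<subseteq> snd x"
          using extend by blast
        then show ?thesis by (intro exI[of _ "(n, V)"]) simp
      qed
    qed
    then show ?thesis using that by blast
  qed
  define n where "n = (\<lambda>k. fst (F k))"
  define V where "V = (\<lambda>k. snd (F k))"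
  have nV: "n k \<in> Z" "V k \<subseteq> Z" "infinite (V k)" "v \<in> V k \<Longrightarrow> n k < v"
    "homogeneous (\<lambda>Y. c (insert (n k) Y)) (V k)" for k v
    using F(1)[of k] by (auto simp: good_def n_def V_def split: prod.splits)
  have V_Suc: "V (Suc k) \<subseteq> V k" for k
    using F(2)[of k] by (simp add: V_def)
  have V_anti: "V l \<subseteq> V k" if "k \<le> l" for k l
    using V_Suc that by (rule lift_Suc_antimono_le)
  have n_in_V: "n l \<in> V k" if "k < l" for k l
  proof -
    obtain l' where l': "l = Suc l'" using \<open>k < l\<close> by (cases l) auto
    have "n l \<in> V l'" using F(2)[of l'] by (simp add: l' n_def V_def)
    then show ?thesis using V_anti[of k l'] that l' by auto
  qed
  have n_mono: "strict_mono n"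
    using n_in_V nV(4) by (simp add: strict_mono_def)
  \<comment> \<open>A set of \<open>n\<^sub>k\<close>'s gets the colour decided by its least element.\<close>
  define K where "K = {k. \<forall>Y\<subseteq>V k. infinite Y \<longrightarrow> c (insert (n k) Y)}"
  have decompose: "\<exists>k\<in>J. \<exists>Y'\<subseteq>V k. infinite Y' \<and> Y = insert (n k) Y'"
    if Y: "Y \<subseteq> n ` J" "infinite Y" for Y J
  proof -
    obtain k where k: "k \<in> J" "Inf Y = n k"
      using Inf_mem_infinite[OF Y(2)] Y(1) by blast
    have "drop_least Y \<subseteq> V k"
    proof
      fix y assume y: "y \<in> drop_least Y"
      then obtain l where "y = n l"
        using Y(1) drop_least_subset by blast
      moreover have "n k < y"
        using Inf_less_drop_least[OF y] k by simp
      ultimately show "y \<in> V k"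
        using n_in_V n_mono by (simp add: strict_mono_less)
    qed
    moreover have "Y = insert (n k) (drop_least Y)"
      using Inf_mem_infinite[OF Y(2)] k by (auto simp: drop_least_def)
    ultimately show ?thesis
      using k infinite_drop_least[OF Y(2)] by blast
  qed
  have K_yes: "homogeneous c (n ` K)"
  proof -
    have "c Y" if "Y \<subseteq> n ` K" "infinite Y" for Y
      using decompose[OF that] unfolding K_def by blast
    then show ?thesis by (simp add: homogeneous_def)
  qed
  have K_no: "homogeneous c (n ` (- K))"
  proof -
    have "\<not> c (insert (n k) Y)" if "k \<notin> K" "Y \<subseteq> V k" "infinite Y" for k Y
      using nV(5)[of k] that unfolding homogeneous_def K_def by blast
    then have "\<not> c Y" if "Y \<subseteq> n ` (- K)" "infinite Y" for Y
      using decompose[OF that] by blast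
    then show ?thesis by (simp add: homogeneous_def)
  qed
  have "infinite K \<or> infinite (- K)"
    using finite_UnI[of K "- K"] by (auto simp: Compl_partition)
  then have "infinite (n ` K) \<or> infinite (n ` (- K))"
    using strict_mono_imp_inj_on[OF n_mono] by (meson finite_imageD inj_on_subset subset_UNIV)
  then show "\<exists>W\<subseteq>Z. infinite W \<and> homogeneous c W"
    using K_yes K_no nV(1) by (metis image_subsetI)
qed

text \<open>
  If the colouring \<open>c\<close> fails to be Ramsey, then so do its derivatives along some increasing sequence
  of elements, by the previous lemma. But \<open>c\<close> is constant on all sets that agree with the range
  \<open>Y\<close> of that sequence up to some \<open>m\<close>, hence the derivative at \<open>Y \<inter> {..m}\<close> is constant on the sets
  above \<open>m\<close>, which makes it Ramsey for a trivial reason.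
\<close>
theorem ramsey_locally_constant:
  assumes lc: "locally_constant_on X c"
  shows "ramsey_in X c"
proof (rule ccontr)
  assume not: "\<not> ramsey_in X c"
  define derived where "derived = (\<lambda>S Y. c (S \<union> Y))"
  have "\<exists>F. \<forall>k. (finite (F k) \<and> F k \<subseteq> X \<and> \<not> ramsey_in X (derived (F k))) \<and>
      (\<exists>n. (\<forall>s\<in>F k. s < n) \<and> F (Suc k) = insert n (F k))"
  proof (rule dependent_nat_choice[where P = "\<lambda>_ S. finite S \<and> S \<subseteq> X \<and> \<not> ramsey_in X (derived S)" and
        Q = "\<lambda>_ S S'. \<exists>n. (\<forall>s\<in>S. s < n) \<and> S' = insert n S"])
    show "\<exists>S. finite S \<and> S \<subseteq> X \<and> \<not> ramsey_in X (derived S)"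
      using not by (intro exI[of _ "{}"]) (simp add: derived_def)
    fix S k assume S: "finite S \<and> S \<subseteq> X \<and> \<not> ramsey_in X (derived S)"
    then obtain m where m: "\<forall>s\<in>S. s \<le> m"
      using finite_nat_set_iff_bounded_le by blast
    obtain n where n: "n \<in> X" "m < n" "\<not> ramsey_in X (\<lambda>Y. derived S (insert n Y))"
      using ramsey_in_if_derived_ramsey[of X m "derived S"] S by blast
    then have "\<not> ramsey_in X (derived (insert n S))"
      by (simp add: derived_def)
    then show "\<exists>S'. (finite S' \<and> S' \<subseteq> X \<and> \<not> ramsey_in X (derived S')) \<and>
        (\<exists>n. (\<forall>s\<in>S. s < n) \<and> S' = insert n S)"
      using n m S by (intro exI[of _ "insert n S"] conjI exI[of _ n]) auto
  qed
  then obtain F n where F: "\<And>k. finite (F k)" "\<And>k. F k \<subseteq> X"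
      "\<And>k. \<not> ramsey_in X (derived (F k))"
      and n: "\<And>k s. s \<in> F k \<Longrightarrow> s < n k" "\<And>k. F (Suc k) = insert (n k) (F k)"
    by metis
  have F_Suc: "F k \<subseteq> F (Suc k)" for k
    using n(2)[of k] by blast
  have F_mono: "F k \<subseteq> F l" if "k \<le> l" for k l
    using F_Suc that by (rule lift_Suc_mono_le)
  have n_less: "n k < n l" if "k < l" for k l
    using n(1)[of "n k" l] n(2)[of k] F_mono[of "Suc k" l] that by auto
  define Y where "Y = (\<Union>k. F k)"
  have "range n \<subseteq> Y"
    using n(2) unfolding Y_def by blast
  moreover have "infinite (range n)"
    using n_less by (intro range_inj_infinite) (metis injI linorder_neq_iff)
  ultimately have "infinite Y"
    by (meson finite_subset)
  have "Y \<subseteq> X"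
    using F(2) unfolding Y_def by blast
  note Y = \<open>Y \<subseteq> X\<close> \<open>infinite Y\<close>
  obtain m where m: "\<forall>Z\<subseteq>X. infinite Z \<and> Z \<inter> {..m} = Y \<inter> {..m} \<longrightarrow> c Z = c Y"
    using locally_constant_onD[OF lc Y] by blast
  \<comment> \<open>Elements that enter \<open>Y\<close> after stage \<open>m\<close> exceed \<open>m\<close>, so \<open>F (Suc m)\<close> is long enough.\<close>
  have n_ge: "k \<le> n k" for k
    using n_less by (simp add: strict_mono_imp_increasing strict_mono_def)
  have Y_low: "Y \<inter> {..m} \<subseteq> F (Suc m)"
  proof
    fix y assume y: "y \<in> Y \<inter> {..m}"
    then obtain l where l: "y \<in> F l" by (auto simp: Y_def)
    have "y \<in> F (Suc m)" if "y \<in> F l" for l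
      using that
    proof (induction l)
      case 0
      then show ?case using F_mono by blast
    next
      case (Suc l)
      show ?case
      proof (cases "l \<le> m")
        case True
        then show ?thesis using Suc.prems F_mono[of "Suc l" "Suc m"] by auto
      next
        case False
        then have "y \<noteq> n l" using y n_ge[of l] by auto
        then show ?thesis using Suc n(2) by auto
      qed
    qed
    then show "y \<in> F (Suc m)" using l by blast
  qed
  have "ramsey_in X (derived (F (Suc m)))"
    unfolding ramsey_in_def
  proof (intro allI impI)
    fix Z assume Z: "Z \<subseteq> X" "infinite Z"
    have inf: "infinite (Z - {..m})"
      using Z(2) by simp
    have "derived (F (Suc m)) Y' = c Y" if Y': "Y' \<subseteq> Z - {..m}" "infinite Y'" for Y'
      unfolding derived_def
    proof (rule m[rule_format, OF _ conjI])
      show "F (Suc m) \<union> Y' \<subseteq> X" using F(2) Z Y' by blast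
      show "infinite (F (Suc m) \<union> Y')" using Y' by simp
      show "(F (Suc m) \<union> Y') \<inter> {..m} = Y \<inter> {..m}"
        using Y' Y_low by (auto simp: Y_def)
    qed
    then have "homogeneous (derived (F (Suc m))) (Z - {..m})"
      unfolding homogeneous_def by (cases "c Y") auto
    then show "\<exists>W\<subseteq>Z. infinite W \<and> homogeneous (derived (F (Suc m))) W"
      using inf by blast
  qed
  then show False using F(3) by blast
qed

text \<open>
  Otherwise removing least elements one after the other gives an infinite descent in \<open>\<nat>\<close>.
\<close>
lemma no_descent_along_drop_least:
  fixes f :: "nat set \<Rightarrow> nat"
  assumes "infinite W"
  shows "\<exists>Y\<subseteq>W. infinite Y \<and> f Y \<le> f (drop_least Y)"
proof (rule ccontr)
  assume "\<not> ?thesis"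
  then have desc: "f (drop_least Y) < f Y" if "Y \<subseteq> W" "infinite Y" for Y
    using that by (meson linorder_not_le)
  have "Y \<subseteq> W \<Longrightarrow> infinite Y \<Longrightarrow> False" for Y
  proof (induction "f Y" arbitrary: Y rule: less_induct)
    case less
    then show ?case
      using desc infinite_drop_least drop_least_subset by (meson order_trans)
  qed
  then show False using assms by blast
qed

text \<open>
  This is the statement that \<open>\<nat> \<times> \<nat>\<close> is a better quasi-order. On a homogeneous set for the colouring
  that tells whether \<open>p\<close> drops, the absence of infinite descents excludes that \<open>p\<close> always drops, and
  then it produces a set at which \<open>q\<close> does not drop either.
\<close>
theorem locally_constant_nat_pair_good:
  fixes p q :: "nat set \<Rightarrow> nat"
  assumes X: "infinite X"
    and lc: "locally_constant_on X p"
  shows "\<exists>Y\<subseteq>X. infinite Y \<and> p Y \<le> p (drop_least Y) \<and> q Y \<le> q (drop_least Y)"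
proof -
  have "locally_constant_on X (\<lambda>Y. (p Y, p (drop_least Y)))"
    by (intro locally_constant_on_Pair locally_constant_on_drop_least lc)
  from locally_constant_on_compose[OF this, of "\<lambda>(k, l). k \<le> l"]
  have "ramsey_in X (\<lambda>Y. p Y \<le> p (drop_least Y))"
    by (intro ramsey_locally_constant) simp
  then obtain W where W: "W \<subseteq> X" "infinite W" "homogeneous (\<lambda>Y. p Y \<le> p (drop_least Y)) W"
    using X unfolding ramsey_in_def by blast
  then have asc: "\<forall>Y\<subseteq>W. infinite Y \<longrightarrow> p Y \<le> p (drop_least Y)"
    using no_descent_along_drop_least[of W p] unfolding homogeneous_def by blast
  obtain Y where "Y \<subseteq> W" "infinite Y" "q Y \<le> q (drop_least Y)"
    using no_descent_along_drop_least[of W q] W by blast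
  then show ?thesis
    using asc W by (meson order_trans)
qed

section \<open>Barriers as locally constant functions\<close>

definition barrier_segment :: "nat set set \<Rightarrow> nat set \<Rightarrow> nat set" where
  "barrier_segment B Y = (SOME b. b \<in> B \<and> initial_segment b Y)"

context
  fixes X B
  assumes B: "barrier_on X B"
begin

lemma barrier_segment:
  assumes "Y \<subseteq> X" "infinite Y"
  shows "barrier_segment B Y \<in> B" "initial_segment (barrier_segment B Y) Y"
proof -
  have "\<exists>b. b \<in> B \<and> initial_segment b Y"
    using B assms unfolding barrier_on_def by blast
  from someI_ex[OF this] show "barrier_segment B Y \<in> B" "initial_segment (barrier_segment B Y) Y"
    by (auto simp: barrier_segment_def)
qed

text \<open>
  Two initial segments of \<open>Y\<close> are comparable, while the members of a barrier are not.
\<close>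
lemma barrier_segment_eqI:
  assumes "Y \<subseteq> X" "infinite Y" "b \<in> B" "initial_segment b Y"
  shows "barrier_segment B Y = b"
proof -
  let ?b = "barrier_segment B Y"
  have "?b \<subseteq> b \<or> b \<subseteq> ?b"
  proof (rule ccontr)
    assume "\<not> ?thesis"
    then obtain x y where xy: "x \<in> ?b" "x \<notin> b" "y \<in> b" "y \<notin> ?b"
      by blast
    then have "x \<in> Y" "y \<in> Y"
      using barrier_segment(2)[OF assms(1,2)] assms(4) by (auto simp: initial_segment_def)
    moreover have "x < y \<or> y < x" using xy by (metis linorder_neqE_nat)
    ultimately show False
      using xy barrier_segment(2)[OF assms(1,2)] assms(4) by (auto simp: initial_segment_def)
  qed
  moreover have "\<not> ?b \<subset> b" "\<not> b \<subset> ?b"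
    using B barrier_segment(1)[OF assms(1,2)] assms(3) by (simp_all add: barrier_on_def)
  ultimately show ?thesis by blast
qed

lemma locally_constant_on_barrier_segment: "locally_constant_on X (barrier_segment B)"
  unfolding locally_constant_on_def
proof (intro allI impI)
  fix Y assume Y: "Y \<subseteq> X" "infinite Y"
  let ?b = "barrier_segment B Y"
  note b = barrier_segment[OF Y]
  have "finite ?b"
    using b(1) B by (simp add: barrier_on_def)
  then obtain m where m: "\<forall>x\<in>?b. x \<le> m"
    by (auto simp: finite_nat_set_iff_bounded_le)
  have "barrier_segment B Z = ?b" if Z: "Z \<subseteq> X" "infinite Z" "Z \<inter> {..m} = Y \<inter> {..m}" for Z
  proof (rule barrier_segment_eqI[OF Z(1,2) b(1)])
    have "x \<in> Z \<longleftrightarrow> x \<in> Y" if "x \<le> m" for x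
      using Z(3) that by (auto simp: set_eq_iff)
    then show "initial_segment ?b Z"
      using b(2) m unfolding initial_segment_def
      by (meson less_le_trans order_less_imp_le subset_iff)
  qed
  then show "\<exists>m. \<forall>Z\<subseteq>X. infinite Z \<and> Z \<inter> {..m} = Y \<inter> {..m} \<longrightarrow> barrier_segment B Z = ?b"
    by blast
qed

text \<open>
  The segment \<open>b\<close> of \<open>Y\<close> starts with \<open>Inf Y\<close>, and \<open>b - {Inf Y}\<close> and the segment \<open>b'\<close> of
  \<open>drop_least Y\<close> are initial segments of the same set. As \<open>b'\<close> is not contained in \<open>b\<close>, it is
  the longer one of the two, hence \<open>b - {Inf Y}\<close> survives the removal of the last element of \<open>b'\<close>.
\<close>
lemma shift_rel_barrier_segment:
  assumes Y: "Y \<subseteq> X" "infinite Y"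
  shows "shift_rel (barrier_segment B Y) (barrier_segment B (drop_least Y))"
proof -
  let ?Y' = "drop_least Y"
  let ?b = "barrier_segment B Y" and ?b' = "barrier_segment B ?Y'"
  have Y': "?Y' \<subseteq> X" "infinite ?Y'"
    using Y drop_least_subset infinite_drop_least by blast+
  note b = barrier_segment[OF Y] and b' = barrier_segment[OF Y']
  have fin: "finite ?b" "?b \<noteq> {}" "finite ?b'" "?b' \<noteq> {}"
    using B b(1) b'(1) by (simp_all add: barrier_on_def)
  have "Min ?b \<le> Inf Y"
    using b(2) Inf_mem_infinite[OF Y(2)] fin unfolding initial_segment_def
    by (metis Min_in Min_le linorder_not_le)
  moreover have "Inf Y \<le> Min ?b"
    using b(2) fin unfolding initial_segment_def
    by (meson Min_in cInf_lower bdd_below_bot subsetD)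
  ultimately have min: "Min ?b = Inf Y" by simp
  have less: "Min ?b < Min ?b'"
    using b'(2) fin min Inf_less_drop_least[of _ Y] unfolding initial_segment_def
    by (metis Min_in subsetD)
  have Inf_notin: "Inf Y \<notin> ?b'"
    using less fin min by auto
  have not_sub: "\<not> ?b' \<subseteq> ?b"
  proof
    assume "?b' \<subseteq> ?b"
    moreover have "Inf Y \<in> ?b" using Min_in[OF fin(1,2)] min by simp
    ultimately have "?b' \<subset> ?b" using Inf_notin by blast
    then show False using B b(1) b'(1) by (simp add: barrier_on_def)
  qed
  then obtain z where z: "z \<in> ?b'" "z \<notin> ?b" by blast
  have zY: "z \<in> Y"
    using z b'(2) drop_least_subset unfolding initial_segment_def by blast
  have below_z: "x < z" if "x \<in> ?b" for x
    using b(2) zY z(2) that unfolding initial_segment_def by (metis linorder_neqE_nat)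
  have "x \<in> ?b' - {Max ?b'}" if x: "x \<in> ?b - {Min ?b}" for x
  proof -
    have "x \<in> ?Y'"
      using x b(2) min unfolding initial_segment_def drop_least_def by auto
    then have "x \<in> ?b'"
      using b'(2) below_z x z unfolding initial_segment_def by blast
    moreover have "x < Max ?b'"
      using below_z[of x] x z fin by (meson DiffD1 Max_ge less_le_trans)
    ultimately show ?thesis by simp
  qed
  then have sub: "?b - {Min ?b} \<subseteq> ?b' - {Max ?b'}" by (rule subsetI)
  have closed: "x \<in> ?b - {Min ?b}"
    if "x \<in> ?b' - {Max ?b'}" "y \<in> ?b - {Min ?b}" "x < y" for x y
  proof -
    have "x \<in> Y"
      using that(1) b'(2) drop_least_subset unfolding initial_segment_def by blast
    then have "x \<in> ?b"
      using that(2,3) b(2) unfolding initial_segment_def by blast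
    then show ?thesis
      using that(1) Inf_notin min by auto
  qed
  have seg: "initial_segment (?b - {Min ?b}) (?b' - {Max ?b'})"
    unfolding initial_segment_def
  proof (intro conjI ballI impI)
    show "?b - {Min ?b} \<subseteq> ?b' - {Max ?b'}" by (rule sub)
  qed (rule closed)
  show ?thesis
    unfolding shift_rel_def by (intro conjI fin less seg)
qed

end

section \<open>Down-closed and stable sets of monomials\<close>

definition down_closed :: "nat multiset set \<Rightarrow> bool" where
  "down_closed D \<longleftrightarrow> (\<forall>x M. add_mset x M \<in> D \<longrightarrow> M \<in> D)"

text \<open>
  Together with closure under removing one element, closure under replacing \<open>Suc x\<close> by \<open>x\<close> says that
  the monomials outside the set form a strongly stable ideal (for the order of variables in which
  larger indices come first).
\<close>
definition stable :: "nat multiset set \<Rightarrow> bool" where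
  "stable D \<longleftrightarrow> (\<forall>x M. add_mset (Suc x) M \<in> D \<longrightarrow> add_mset x M \<in> D)"

definition hilbert_function :: "nat multiset set \<Rightarrow> nat \<Rightarrow> nat" where
  "hilbert_function D a = card {M \<in> D. size M = a}"

lemma finite_degree_part:
  assumes "finite A" "D \<subseteq> {M. set_mset M \<subseteq> A}"
  shows "finite {M \<in> D. size M = a}"
  using assms(2) by (intro finite_subset[OF _ finite_multisets_of_size[OF assms(1), of a]])
    (auto simp: multisets_of_size_def)

lemma hilbert_function_mono:
  assumes "D' \<subseteq> {M. set_mset M \<subseteq> A}" "finite A" "D \<subseteq> D'"
  shows "hilbert_function D \<le> hilbert_function D'"
  using assms by (auto simp: le_fun_def hilbert_function_def intro!: card_mono finite_degree_part)

section \<open>Lexicographically greatest members of closed families\<close>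

text \<open>
  A closed family of subsets of a countable set is compact, so the lexicographic maximum is attained:
  decide the elements one by one in the order of their ranks, taking each of them if some member of
  the family that agrees with the decisions made so far contains it. The hypothesis \<open>closed\<close> says
  that a set belongs to the family as soon as each finite part of it is realised by a member.
\<close>
lemma lex_greatest_exists:
  fixes r :: "'a \<Rightarrow> nat" and T :: "'a set set"
  assumes "inj r" "T \<noteq> {}"
    and closed: "\<And>A. \<forall>k. \<exists>B\<in>T. \<forall>x. r x < k \<longrightarrow> (x \<in> A \<longleftrightarrow> x \<in> B) \<Longrightarrow> A \<in> T"
  shows "\<exists>A\<in>T. \<forall>B\<in>T. \<forall>x\<in>B. (\<forall>y. r y < r x \<longrightarrow> (y \<in> A \<longleftrightarrow> y \<in> B)) \<longrightarrow> x \<in> A"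
proof -
  \<comment> \<open>\<open>S k\<close> consists of the members that comply with the decisions on ranks below \<open>k\<close>.\<close>
  define refine where "refine = (\<lambda>k S :: 'a set set.
    if \<exists>B\<in>S. \<exists>x\<in>B. r x = k then {B \<in> S. \<exists>x\<in>B. r x = k} else S)"
  define S where "S = rec_nat T refine"
  have S_simps: "S 0 = T" "\<And>k. S (Suc k) = refine k (S k)"
    by (simp_all add: S_def)
  have S_Suc: "S (Suc k) \<subseteq> S k" for k
    by (auto simp: S_simps refine_def)
  have S_anti: "S l \<subseteq> S k" if "k \<le> l" for k l
    using S_Suc that by (rule lift_Suc_antimono_le)
  have S_nonempty: "S k \<noteq> {}" for k
    using assms(2) by (induction k) (auto simp: S_simps refine_def)
  define A where "A = {x. \<forall>B\<in>S (Suc (r x)). x \<in> B}"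
  have S_agree: "x \<in> A \<longleftrightarrow> x \<in> B" if "B \<in> S k" "r x < k" for B k x
  proof -
    have B: "B \<in> S (Suc (r x))"
      using S_anti[of "Suc (r x)" k] that by auto
    show ?thesis
    proof (cases "\<exists>B\<in>S (r x). \<exists>y\<in>B. r y = r x")
      case True
      then have "x \<in> B'" if "B' \<in> S (Suc (r x))" for B'
        using that injD[OF assms(1)] by (auto simp: S_simps refine_def split: if_splits)
      then show ?thesis using B by (auto simp: A_def)
    next
      case False
      then show ?thesis using B by (auto simp: A_def S_simps refine_def)
    qed
  qed
  have "A \<in> T"
  proof (intro closed allI)
    fix k
    obtain B where "B \<in> S k" using S_nonempty[of k] by blast
    then show "\<exists>B\<in>T. \<forall>x. r x < k \<longrightarrow> (x \<in> A \<longleftrightarrow> x \<in> B)"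
      using S_agree S_anti[of 0 k] by (auto simp: S_simps)
  qed
  moreover have agree_S: "B \<in> S k" if "B \<in> T" "\<And>x. r x < k \<Longrightarrow> x \<in> A \<longleftrightarrow> x \<in> B" for B k
    using that
  proof (induction k)
    case 0
    then show ?case by (simp add: S_simps)
  next
    case (Suc k)
    then have B: "B \<in> S k" by simp
    show ?case
    proof (cases "\<exists>B\<in>S k. \<exists>x\<in>B. r x = k")
      case True
      then obtain B' x where x: "B' \<in> S (Suc k)" "x \<in> B'" "r x = k"
        by (auto simp: S_simps refine_def)
      then have "x \<in> A" using S_agree by auto
      then have "x \<in> B" using Suc.prems(2) x by auto
      then show ?thesis using B x True by (auto simp: S_simps refine_def)
    next
      case False
      then show ?thesis using B by (simp add: S_simps refine_def)
    qed
  qed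
  moreover have "x \<in> A" if x: "B \<in> T" "x \<in> B" "\<And>y. r y < r x \<Longrightarrow> y \<in> A \<longleftrightarrow> y \<in> B" for B x
  proof -
    have B: "B \<in> S (r x)" using agree_S x by blast
    then have "B \<in> S (Suc (r x))" using x(2) by (auto simp: S_simps refine_def)
    then show ?thesis using S_agree x(2) by blast
  qed
  ultimately show ?thesis by blast
qed

section \<open>Compression along two neighbouring variables\<close>

text \<open>
  Monomials are ranked by the integer that results when the \<open>x\<close>-th variable takes the \<open>x\<close>-th prime as
  its value. Unique factorisation makes the rank injective, and replacing a variable by an earlier
  one lowers it.
\<close>
definition prime_code :: "nat multiset \<Rightarrow> nat" where
  "prime_code M = (\<Prod>x\<in>#M. enumerate {p. prime p} x)"

lemma inj_prime_code: "inj prime_code"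
proof (rule injI)
  fix M N assume eq: "prime_code M = prime_code N"
  have fact: "prime_factorization (prime_code K) = image_mset (enumerate {p. prime p}) K" for K
    unfolding prime_code_def using enumerate_in_set[OF primes_infinite]
    by (subst prime_factorization_prod_mset_primes) auto
  have "inj (enumerate {p :: nat. prime p})"
    using strict_mono_enumerate[OF primes_infinite] by (rule strict_mono_imp_inj_on)
  then show "M = N"
    using fact[of M] fact[of N] eq by (metis multiset.inj_map injD)
qed

text \<open>
  If \<open>N\<close> contains neither \<open>i\<close> nor \<open>Suc i\<close>, the multisets \<open>fibre i N d b\<close> for \<open>b \<le> d\<close> are those that
  have \<open>N\<close> as their part away from these two variables and \<open>d\<close> elements among the two. The number
  \<open>b\<close> counts the occurrences of \<open>Suc i\<close>, so that within a fibre the rank increases with \<open>b\<close>.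
\<close>
definition fibre :: "nat \<Rightarrow> nat multiset \<Rightarrow> nat \<Rightarrow> nat \<Rightarrow> nat multiset" where
  "fibre i N d b = N + replicate_mset (d - b) i + replicate_mset b (Suc i)"

lemma prime_code_fibre_less:
  assumes "b < b'" "b' \<le> d"
  shows "prime_code (fibre i N d b) < prime_code (fibre i N d b')"
proof -
  define p where "p = enumerate {p :: nat. prime p}"
  have pos: "0 < p x" for x
    using enumerate_in_set[OF primes_infinite, of x] by (simp add: p_def prime_gt_0_nat)
  have less: "p i < p (Suc i)"
    using enumerate_mono[OF _ primes_infinite, of i "Suc i"] by (simp add: p_def)
  have code_p: "prime_code M = (\<Prod>x\<in>#M. p x)" for M
    by (simp add: prime_code_def p_def)
  have code: "prime_code (fibre i N d c) = prime_code N * p i ^ (d - c) * p (Suc i) ^ c" for c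
    by (simp add: code_p fibre_def)
  have "p i ^ (d - b) * p (Suc i) ^ b = (p i ^ (d - b') * p (Suc i) ^ b) * p i ^ (b' - b)"
    using assms by (simp flip: power_add)
  also have "\<dots> < (p i ^ (d - b') * p (Suc i) ^ b) * p (Suc i) ^ (b' - b)"
    using pos less assms by (intro mult_strict_left_mono power_strict_mono) auto
  also have "\<dots> = p i ^ (d - b') * p (Suc i) ^ b'"
    using assms by (simp flip: power_add add: mult.assoc)
  finally have "p i ^ (d - b) * p (Suc i) ^ b < p i ^ (d - b') * p (Suc i) ^ b'" .
  moreover have "0 < prime_code N"
    unfolding code_p using pos by (induction N) auto
  ultimately show ?thesis
    by (simp add: code mult.assoc)
qed

definition other_part :: "nat \<Rightarrow> nat multiset \<Rightarrow> nat multiset" where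
  "other_part i M = filter_mset (\<lambda>x. x \<noteq> i \<and> x \<noteq> Suc i) M"

definition pair_degree :: "nat \<Rightarrow> nat multiset \<Rightarrow> nat" where
  "pair_degree i M = count M i + count M (Suc i)"

lemma fibre_self: "fibre i (other_part i M) (pair_degree i M) (count M (Suc i)) = M"
  by (rule multiset_eqI) (auto simp: fibre_def other_part_def pair_degree_def)

lemma fibre_coordinates:
  assumes "b \<le> d" "other_part i N = N"
  shows "other_part i (fibre i N d b) = N" "pair_degree i (fibre i N d b) = d"
    "count (fibre i N d b) (Suc i) = b"
proof -
  have "count N i = 0" "count N (Suc i) = 0"
    using assms(2) by (metis (mono_tags, lifting) count_filter_mset other_part_def)+
  then show "other_part i (fibre i N d b) = N" "pair_degree i (fibre i N d b) = d"
    "count (fibre i N d b) (Suc i) = b"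
    using assms by (auto simp: fibre_def other_part_def pair_degree_def)
qed

lemma other_part_idem [simp]: "other_part i (other_part i M) = other_part i M"
  by (simp add: other_part_def filter_filter_mset)

lemma size_fibre: "b \<le> d \<Longrightarrow> size (fibre i N d b) = size N + d"
  by (simp add: fibre_def)

lemma size_eq_pair_degree: "size M = size (other_part i M) + pair_degree i M"
  by (metis fibre_self size_fibre pair_degree_def le_add2)

definition slice :: "nat \<Rightarrow> nat multiset set \<Rightarrow> nat multiset \<Rightarrow> nat \<Rightarrow> nat set" where
  "slice i D N d = {b. b \<le> d \<and> fibre i N d b \<in> D}"

lemma slice_subset: "slice i D N d \<subseteq> {..d}"
  by (auto simp: slice_def)

lemma finite_slice: "finite (slice i D N d)"
  using slice_subset by (rule finite_subset) simp

lemma card_slice_le: "card (slice i D N d) \<le> Suc d"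
  using card_mono[OF _ slice_subset] by fastforce

text \<open>
  In every fibre, the members of \<open>D\<close> are pushed to the monomials with the fewest occurrences of
  \<open>Suc i\<close>, their number being kept.
\<close>
definition compress :: "nat \<Rightarrow> nat multiset set \<Rightarrow> nat multiset set" where
  "compress i D = {M. count M (Suc i) < card (slice i D (other_part i M) (pair_degree i M))}"

lemma fibre_in_compress:
  assumes "b \<le> d" "other_part i N = N"
  shows "fibre i N d b \<in> compress i D \<longleftrightarrow> b < card (slice i D N d)"
  using assms by (simp add: compress_def fibre_coordinates)

lemma slice_compress:
  assumes "other_part i N = N"
  shows "slice i (compress i D) N d = {..<card (slice i D N d)}"
  using assms card_slice_le[of i D N d] by (auto simp: slice_def fibre_in_compress)

text \<open>
  As the fibres of \<open>compress i D\<close> are initial segments, only the cardinalities of the slices of \<open>D\<close>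
  have to be compared. Removing a variable outside the pair maps one slice into another of the
  same degree. Removing a variable of the pair relates the slice \<open>S'\<close> of degree \<open>d + 1\<close> to the slice
  \<open>S\<close> of degree \<open>d\<close>: since \<open>D\<close> is down-closed, \<open>b \<in> S'\<close> implies \<open>b \<in> S\<close> (if \<open>b \<le> d\<close>) and \<open>b - 1 \<in> S\<close>
  (if \<open>b > 0\<close>). So \<open>S'\<close> has at most one element more than \<open>S\<close>, and no more elements than \<open>S\<close> unless
  it is everything.
\<close>
lemma down_closed_compress:
  assumes D: "down_closed D"
  shows "down_closed (compress i D)"
  unfolding down_closed_def
proof (intro allI impI)
  fix x M assume M: "add_mset x M \<in> compress i D"
  let ?N = "other_part i M" and ?d = "pair_degree i M"
  let ?S = "slice i D ?N ?d" and ?S' = "slice i D ?N (Suc ?d)"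
  have down: "K \<in> D" if "add_mset y K \<in> D" for y K
    using D that unfolding down_closed_def by blast
  have drop_snd: "b - 1 \<in> ?S" if "b \<in> ?S'" "0 < b" for b
    using that down[of "Suc i" "fibre i ?N ?d (b - 1)"]
    by (cases b) (auto simp: slice_def fibre_def)
  have drop_fst: "b \<in> ?S" if "b \<in> ?S'" "b \<le> ?d" for b
    using that down[of i "fibre i ?N ?d b"]
    by (auto simp: slice_def fibre_def Suc_diff_le)
  consider "x \<noteq> i" "x \<noteq> Suc i" | "x = i" | "x = Suc i" by blast
  then show "M \<in> compress i D"
  proof cases
    case 1
    have "slice i D (add_mset x ?N) ?d \<subseteq> ?S"
      using down by (auto simp: slice_def fibre_def)
    then have "card (slice i D (add_mset x ?N) ?d) \<le> card ?S"
      by (rule card_mono[OF finite_slice])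
    then show ?thesis
      using M 1 by (auto simp: compress_def other_part_def pair_degree_def)
  next
    case 2
    have M': "count M (Suc i) < card ?S'"
      using M 2 by (simp add: compress_def other_part_def pair_degree_def)
    show ?thesis
    proof (cases "?S' = {..Suc ?d}")
      case True
      then have "?S = {..?d}"
        using drop_fst slice_subset[of i D ?N ?d] by auto
      then show ?thesis by (simp add: compress_def pair_degree_def)
    next
      case False
      then obtain a where a: "a \<le> Suc ?d" "a \<notin> ?S'"
        using slice_subset[of i D ?N "Suc ?d"] by auto
      \<comment> \<open>The gap \<open>a\<close> makes room for shifting the part of \<open>S'\<close> above it down by one.\<close>
      let ?g = "\<lambda>b. if b < a then b else b - 1"
      have inj: "inj_on ?g ?S'"
      proof (rule inj_onI)
        fix b c assume bc: "b \<in> ?S'" "c \<in> ?S'" "?g b = ?g c"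
        then have "b \<noteq> a" "c \<noteq> a" using a(2) by auto
        then show "b = c" using bc(3) by (auto split: if_splits)
      qed
      have "?g ` ?S' \<subseteq> ?S"
      proof (rule image_subsetI)
        fix b assume b: "b \<in> ?S'"
        then have "b \<noteq> a" using a(2) by auto
        then show "?g b \<in> ?S"
          using b a(1) drop_fst[of b] drop_snd[of b] by auto
      qed
      then have "card ?S' \<le> card ?S"
        by (rule card_inj_on_le[OF inj _ finite_slice])
      then show ?thesis using M' by (simp add: compress_def)
    qed
  next
    case 3
    have M': "Suc (count M (Suc i)) < card ?S'"
      using M 3 by (simp add: compress_def other_part_def pair_degree_def)
    have "?S' - {0} \<subseteq> Suc ` ?S"
      using drop_snd by (force simp: image_iff)
    then have "card (?S' - {0}) \<le> card ?S"
      by (meson card_image_le card_mono finite_imageI finite_slice order_trans)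
    moreover have "card ?S' \<le> Suc (card (?S' - {0}))"
      by (metis card_Diff_singleton_if diff_Suc_1 finite_slice card_Suc_Diff1 le_SucI order_refl)
    ultimately show ?thesis using M' by (simp add: compress_def)
  qed
qed

lemma compress_subset:
  assumes "D \<subseteq> {M. set_mset M \<subseteq> A}" "i \<in> A" "Suc i \<in> A"
  shows "compress i D \<subseteq> {M. set_mset M \<subseteq> A}"
proof
  fix M assume "M \<in> compress i D"
  then have "slice i D (other_part i M) (pair_degree i M) \<noteq> {}"
    by (auto simp: compress_def)
  then obtain b where "fibre i (other_part i M) (pair_degree i M) b \<in> D"
    by (auto simp: slice_def)
  then have "set_mset (fibre i (other_part i M) (pair_degree i M) b) \<subseteq> A"
    using assms(1) by blast
  then have "set_mset (other_part i M) \<subseteq> A"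
    by (auto simp: fibre_def)
  then show "M \<in> {M. set_mset M \<subseteq> A}"
    using assms(2,3) by (auto simp: other_part_def)
qed

lemma card_eq_if_fibres:
  assumes "finite P" "finite Q"
    and "\<And>k. card {x \<in> P. g x = k} = card {x \<in> Q. g x = k}"
  shows "card P = card Q"
proof -
  let ?K = "g ` P \<union> g ` Q"
  have "card R = (\<Sum>k\<in>?K. card {x \<in> R. g x = k})" if "finite R" "g ` R \<subseteq> ?K" for R
    using sum.group[OF that(1) _ that(2), of "\<lambda>_. 1 :: nat"] assms(1,2) by simp
  then show ?thesis using assms by simp
qed

lemma hilbert_function_compress:
  assumes D: "D \<subseteq> {M. set_mset M \<subseteq> A}" and C: "compress i D \<subseteq> {M. set_mset M \<subseteq> A}"
    and A: "finite A"
  shows "hilbert_function (compress i D) = hilbert_function D"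
proof
  fix a
  show "hilbert_function (compress i D) a = hilbert_function D a"
    unfolding hilbert_function_def
  proof (rule card_eq_if_fibres[where g = "\<lambda>M. (other_part i M, pair_degree i M)"])
    fix k :: "nat multiset \<times> nat"
    obtain N d where k: "k = (N, d)" by fastforce
    have fib: "card {M \<in> {M \<in> E. size M = a}. (other_part i M, pair_degree i M) = k} =
        (if other_part i N = N \<and> size N + d = a then card (slice i E N d) else 0)" for E
    proof (cases "other_part i N = N \<and> size N + d = a")
      case True
      have "bij_betw (fibre i N d) (slice i E N d)
          {M \<in> {M \<in> E. size M = a}. (other_part i M, pair_degree i M) = k}"
      proof (rule bij_betw_byWitness[where f' = "\<lambda>M. count M (Suc i)"])
        show "(\<lambda>M. count M (Suc i)) ` {M \<in> {M \<in> E. size M = a}. (other_part i M, pair_degree i M) = k}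
            \<subseteq> slice i E N d"
          using fibre_self[of i] by (auto simp: k slice_def pair_degree_def)
      qed (use True fibre_self[of i] in \<open>auto simp: k slice_def fibre_coordinates size_fibre\<close>)
      from bij_betw_same_card[OF this] show ?thesis using True by simp
    next
      case False
      have "other_part i N = N \<and> size N + d = a"
        if "size M = a" "(other_part i M, pair_degree i M) = k" for M
        using that size_eq_pair_degree[of M i] by (auto simp: k)
      then have empty: "{M \<in> {M \<in> E. size M = a}. (other_part i M, pair_degree i M) = k} = {}"
        using False by blast
      show ?thesis unfolding empty by (simp only: card.empty False if_False)
    qed
    show "card {M \<in> {M \<in> compress i D. size M = a}. (other_part i M, pair_degree i M) = k} =
        card {M \<in> {M \<in> D. size M = a}. (other_part i M, pair_degree i M) = k}"
      unfolding fib by (simp add: slice_compress)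
  qed (use finite_degree_part A D C in auto)
qed

text \<open>
  Take the lexicographically greatest \<open>E\<close> among the down-closed sets with the Hilbert function of \<open>D\<close>.
  Such sets form a closed family because each degree contains only finitely many monomials over
  \<open>{..<n}\<close>. Compression does not leave this family, and on every fibre the first place where it
  changes \<open>E\<close> is a gain; so \<open>E\<close> would not be greatest if it were changed at all. A set that is
  unchanged by the compressions is stable.
\<close>
lemma stable_representative:
  assumes D: "D \<subseteq> {M. set_mset M \<subseteq> {..<n}}" "down_closed D"
  obtains E where "E \<subseteq> {M. set_mset M \<subseteq> {..<n}}" "down_closed E" "stable E"
    "hilbert_function E = hilbert_function D"
proof -
  define T where "T = {E. E \<subseteq> {M. set_mset M \<subseteq> {..<n}} \<and> down_closed E \<and>
      hilbert_function E = hilbert_function D}"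
  have "T \<noteq> {}" using D by (auto simp: T_def)
  have closed: "A \<in> T"
    if approx: "\<forall>k. \<exists>B\<in>T. \<forall>x. prime_code x < k \<longrightarrow> (x \<in> A \<longleftrightarrow> x \<in> B)" for A
  proof -
    have approx_finite: "\<exists>B\<in>T. \<forall>x\<in>S. x \<in> A \<longleftrightarrow> x \<in> B" if "finite S" for S
    proof -
      obtain k where "\<forall>x\<in>S. prime_code x < k"
        using finite_nat_set_iff_bounded[of "prime_code ` S"] \<open>finite S\<close> by auto
      then show ?thesis using approx by metis
    qed
    have sub: "A \<subseteq> {M. set_mset M \<subseteq> {..<n}}"
    proof
      fix M assume "M \<in> A"
      then show "M \<in> {M. set_mset M \<subseteq> {..<n}}"
        using approx_finite[of "{M}"] by (auto simp: T_def)
    qed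
    moreover have "down_closed A"
      unfolding down_closed_def
    proof (intro allI impI)
      fix x M assume "add_mset x M \<in> A"
      then show "M \<in> A"
        using approx_finite[of "{M, add_mset x M}"] unfolding T_def down_closed_def by auto
    qed
    moreover have "hilbert_function A a = hilbert_function D a" for a
    proof -
      let ?S = "multisets_of_size {..<n} a"
      obtain B where B: "B \<in> T" "\<forall>x\<in>?S. x \<in> A \<longleftrightarrow> x \<in> B"
        using approx_finite[OF finite_multisets_of_size[OF finite_lessThan]] by blast
      have "B \<subseteq> {M. set_mset M \<subseteq> {..<n}}" using B(1) by (simp add: T_def)
      then have "M \<in> A \<longleftrightarrow> M \<in> B" if "size M = a" for M
        using sub B(2) that unfolding multisets_of_size_def by blast
      then have "{M \<in> A. size M = a} = {M \<in> B. size M = a}" by blast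
      then show ?thesis using B by (simp add: T_def hilbert_function_def fun_eq_iff)
    qed
    ultimately show ?thesis by (simp add: T_def fun_eq_iff)
  qed
  obtain E where E: "E \<in> T" and greatest: "\<forall>B\<in>T. \<forall>x\<in>B.
      (\<forall>y. prime_code y < prime_code x \<longrightarrow> (y \<in> E \<longleftrightarrow> y \<in> B)) \<longrightarrow> x \<in> E"
    using lex_greatest_exists[OF inj_prime_code \<open>T \<noteq> {}\<close> closed] by blast
  have compress_eq: "compress i E = E" if i: "Suc i < n" for i
  proof (rule ccontr)
    assume "compress i E \<noteq> E"
    then obtain x0 where x0: "(x0 \<in> compress i E) \<noteq> (x0 \<in> E)" by blast
    define x where "x = arg_min prime_code (\<lambda>x. (x \<in> compress i E) \<noteq> (x \<in> E))"
    have x: "(x \<in> compress i E) \<noteq> (x \<in> E)"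
      unfolding x_def using x0 by (rule arg_min_natI)
    have least: "y \<in> E \<longleftrightarrow> y \<in> compress i E" if "prime_code y < prime_code x" for y
    proof (rule ccontr)
      assume "(y \<in> E) \<noteq> (y \<in> compress i E)"
      then have "prime_code x \<le> prime_code y"
        unfolding x_def by (intro arg_min_nat_le) blast
      then show False using that by simp
    qed
    have sub: "compress i E \<subseteq> {M. set_mset M \<subseteq> {..<n}}"
      using E i by (intro compress_subset) (auto simp: T_def)
    then have "compress i E \<in> T"
      using E hilbert_function_compress[OF _ sub] down_closed_compress by (simp add: T_def)
    then have "x \<in> E" if "x \<in> compress i E"
      using greatest least that by simp
    then have x_E: "x \<in> E" "x \<notin> compress i E"
      using x by auto
    let ?N = "other_part i x" and ?d = "pair_degree i x" and ?b = "count x (Suc i)"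
    let ?S = "slice i E ?N ?d"
    have b: "?b \<le> ?d" "?b \<in> ?S" "card ?S \<le> ?b"
      using x_E fibre_self[of i x] by (auto simp: slice_def pair_degree_def compress_def)
    \<comment> \<open>Up to \<open>x\<close> the two sets agree, so the slice contains all of \<open>{..<card ?S}\<close> in addition to the
      larger number \<open>?b\<close>, which is one element too many.\<close>
    have "c \<in> ?S" if "c < card ?S" for c
    proof -
      have "c < ?b" using that b by simp
      then have "fibre i ?N ?d c \<in> E \<longleftrightarrow> fibre i ?N ?d c \<in> compress i E"
        using least prime_code_fibre_less[of c ?b ?d i ?N] b(1) by (simp add: fibre_self)
      then show ?thesis
        using that b \<open>c < ?b\<close> by (simp add: slice_def fibre_in_compress)
    qed
    then have "insert ?b {..<card ?S} \<subseteq> ?S" using b by auto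
    then have "card (insert ?b {..<card ?S}) \<le> card ?S"
      by (rule card_mono[OF finite_slice])
    then show False using b by simp
  qed
  have "stable E"
    unfolding stable_def
  proof (intro allI impI)
    fix i M assume M: "add_mset (Suc i) M \<in> E"
    then have "Suc i < n" using E by (auto simp: T_def)
    note eq = compress_eq[OF this]
    have "add_mset (Suc i) M \<in> compress i E" using M eq by simp
    then have "add_mset i M \<in> compress i E"
      by (simp add: compress_def other_part_def pair_degree_def)
    then show "add_mset i M \<in> E" using eq by simp
  qed
  then show ?thesis using that E by (auto simp: T_def)
qed

section \<open>Stable sets and Young diagrams\<close>

text \<open>
  The pairs \<open>(x, k)\<close> with \<open>k < tail_count M x\<close> form the Young diagram of the partition whose parts
  are the numbers \<open>y + 1\<close> for \<open>y\<close> in \<open>M\<close>.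
\<close>
definition tail_count :: "nat multiset \<Rightarrow> nat \<Rightarrow> nat" where
  "tail_count M x = size (filter_mset (\<lambda>y. x \<le> y) M)"

lemma tail_count_antimono: "x \<le> y \<Longrightarrow> tail_count M y \<le> tail_count M x"
  unfolding tail_count_def by (induction M) auto

lemma tail_count_Suc: "tail_count M x = tail_count M (Suc x) + count M x"
  unfolding tail_count_def by (induction M) auto

lemma tail_count_add_mset:
  "tail_count (add_mset y M) x = tail_count M x + (if x \<le> y then 1 else 0)"
  by (simp add: tail_count_def)

text \<open>
  Reduce \<open>M'\<close> to \<open>M\<close> by small steps. As long as the two differ, there is an \<open>x\<close> at which their
  tail counts differ while those at \<open>Suc x\<close> agree: then \<open>x\<close> occurs in \<open>M'\<close>, and replacing one occurrence of it by its predecessor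
  (removing it if \<open>x = 0\<close>) lowers the tail count at \<open>x\<close> only, so that the result still dominates \<open>M\<close>.
\<close>
lemma stable_dominated:
  assumes D: "down_closed D" "stable D"
  shows "M' \<in> D \<Longrightarrow> (\<And>x. tail_count M x \<le> tail_count M' x) \<Longrightarrow> M \<in> D"
proof (induction "\<Sum>x\<in>#M'. Suc x" arbitrary: M' rule: less_induct)
  case less
  show ?case
  proof (cases "\<exists>x. tail_count M x < tail_count M' x")
    case False
    then have "tail_count M x = tail_count M' x" for x
      using less.prems(2)[of x] by (meson le_neq_implies_less)
    then have "count M x = count M' x" for x
      using tail_count_Suc[of M x] tail_count_Suc[of M' x] by simp
    then have "M = M'" by (rule multiset_eqI)
    then show ?thesis using less.prems by simp
  next
    case True
    have "x \<in># M'" if "tail_count M x < tail_count M' x" "\<not> tail_count M (Suc x) < tail_count M' (Suc x)" for x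
    proof -
      have "0 < count M' x"
        using that tail_count_Suc[of M x] tail_count_Suc[of M' x] by linarith
      then show ?thesis by simp
    qed
    moreover have "\<exists>x. tail_count M x < tail_count M' x \<and> \<not> tail_count M (Suc x) < tail_count M' (Suc x)"
    proof (rule ccontr)
      assume *: "\<not> ?thesis"
      obtain x0 where "tail_count M x0 < tail_count M' x0" using True by blast
      then have less: "tail_count M (x0 + k) < tail_count M' (x0 + k)" for k
        using * by (induction k) auto
      obtain m where "\<forall>y\<in>#M'. y < m"
        using finite_nat_set_iff_bounded[of "set_mset M'"] by auto
      then have "tail_count M' (x0 + m) = 0"
        unfolding tail_count_def by (auto simp: filter_mset_eq_mempty_iff)
      then show False using less[of m] by simp
    qed
    ultimately obtain x where x: "x \<in># M'" "tail_count M x < tail_count M' x" by blast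
    then obtain K where K: "M' = add_mset x K" by (metis mset_add)
    show ?thesis
    proof (cases x)
      case 0
      show ?thesis
      proof (rule less.hyps[of K])
        show "K \<in> D" using D(1) less.prems(1) K unfolding down_closed_def by blast
        show "tail_count M y \<le> tail_count K y" for y
          using less.prems(2)[of y] x(2) K 0 by (cases y) (auto simp: tail_count_add_mset)
      qed (simp add: K)
    next
      case (Suc z)
      show ?thesis
      proof (rule less.hyps[of "add_mset z K"])
        show "add_mset z K \<in> D" using D(2) less.prems(1) K Suc unfolding stable_def by blast
        show "tail_count M y \<le> tail_count (add_mset z K) y" for y
          using less.prems(2)[of y] x(2) K Suc
          by (cases "y = x") (auto simp: tail_count_add_mset split: if_splits)
      qed (simp add: K Suc)
    qed
  qed
qed

text \<open>
  The passage from exponent vectors to multisets: \<open>vec\<close> is a bijection from the multisets over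
  \<open>{..<n}\<close> to the \<open>n\<close>-tuples that turns size into sum and inclusion into the product ordering.
\<close>
lemma Hilb_stable_representative:
  assumes "h \<in> Hilb"
  obtains n E where "E \<subseteq> {M. set_mset M \<subseteq> {..<n}}" "down_closed E" "stable E"
    "hilbert_function E = h"
proof -
  obtain n F where F: "final_segment n F" "h = hilb n F"
    using assms by (auto simp: Hilb_def Hilb_dim_def)
  define vec where "vec = (\<lambda>M. map (count M) [0..<n])"
  define D where "D = {M. set_mset M \<subseteq> {..<n} \<and> vec M \<notin> F}"
  have "down_closed D"
    unfolding down_closed_def
  proof (intro allI impI)
    fix x M assume "add_mset x M \<in> D"
    moreover have "list_all2 (\<le>) (vec M) (vec (add_mset x M))"
      by (auto simp: vec_def list_all2_conv_all_nth)
    ultimately show "M \<in> D"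
      using F(1) by (auto simp: D_def final_segment_def tuples_def vec_def)
  qed
  have sum_vec: "sum_list (vec M) = size M" if "set_mset M \<subseteq> {..<n}" for M
  proof -
    have "size M = (\<Sum>x<n. count M x)"
      unfolding size_multiset_overloaded_eq using that
      by (intro sum.mono_neutral_left) (auto simp: count_eq_zero_iff)
    then show ?thesis by (simp add: vec_def interv_sum_list_conv_sum_set_nat atLeast0LessThan)
  qed
  have "hilb n F a = hilbert_function D a" for a
  proof -
    have inj: "inj_on vec {M. set_mset M \<subseteq> {..<n}}"
    proof (rule inj_onI)
      fix M N assume MN: "M \<in> {M. set_mset M \<subseteq> {..<n}}" "N \<in> {M. set_mset M \<subseteq> {..<n}}"
        "vec M = vec N"
      show "M = N"
      proof (rule multiset_eqI)
        fix x
        show "count M x = count N x"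
        proof (cases "x < n")
          case True
          then show ?thesis using arg_cong[OF MN(3), of "\<lambda>v. v ! x"] by (simp add: vec_def)
        next
          case False
          then have "x \<notin># M" "x \<notin># N" using MN by auto
          then show ?thesis by (simp add: not_in_iff)
        qed
      qed
    qed
    have surj: "\<exists>M. set_mset M \<subseteq> {..<n} \<and> vec M = v" if "length v = n" for v
    proof -
      let ?M = "\<Sum>x<n. replicate_mset (v ! x) x"
      have count: "count ?M x = (if x < n then v ! x else 0)" for x
        by (simp add: count_sum)
      have "set_mset ?M \<subseteq> {..<n}"
      proof
        fix x assume "x \<in># ?M"
        then have "count ?M x \<noteq> 0" by (simp only: count_eq_zero_iff not_not)
        then show "x \<in> {..<n}" unfolding count by (simp split: if_splits)
      qed
      moreover have "vec ?M = v"
        using that count by (auto simp: vec_def intro!: nth_equalityI)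
      ultimately show ?thesis by blast
    qed
    have image: "vec ` {M \<in> D. size M = a} = {v \<in> tuples n - F. sum_list v = a}"
    proof
      show "vec ` {M \<in> D. size M = a} \<subseteq> {v \<in> tuples n - F. sum_list v = a}"
        using sum_vec by (auto simp: D_def tuples_def) (simp add: vec_def)
      show "{v \<in> tuples n - F. sum_list v = a} \<subseteq> vec ` {M \<in> D. size M = a}"
      proof
        fix v assume v: "v \<in> {v \<in> tuples n - F. sum_list v = a}"
        then obtain M where "set_mset M \<subseteq> {..<n}" "vec M = v"
          using surj[of v] by (auto simp: tuples_def)
        then show "v \<in> vec ` {M \<in> D. size M = a}"
          using v sum_vec[of M] by (auto simp: D_def)
      qed
    qed
    have "inj_on vec {M \<in> D. size M = a}"
      using inj by (rule inj_on_subset) (auto simp: D_def)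
    from card_image[OF this] show ?thesis
      unfolding hilb_def hilbert_function_def image .
  qed
  then have "hilbert_function D = h" using F(2) by auto
  moreover have "D \<subseteq> {M. set_mset M \<subseteq> {..<n}}" by (auto simp: D_def)
  ultimately show ?thesis
    using stable_representative[OF _ \<open>down_closed D\<close>] that by metis
qed

text \<open>
  This is the statement that inclusion of down-closed stable sets is a better quasi-order.
  If \<open>D Y\<close> is never contained in \<open>D Y'\<close>, where \<open>Y'\<close> is \<open>drop_least Y\<close>, pick \<open>M Y\<close> in the difference. As \<open>M Y'\<close> is a member
  of \<open>D Y'\<close> and \<open>M Y\<close> is not, \<open>M Y'\<close> does not dominate \<open>M Y\<close>; pick a point \<open>(p Y, q Y)\<close> in the diagram
  of \<open>M Y\<close> but not in that of \<open>M Y'\<close>. For the same reason as before, \<open>(p Y, q Y) \<le> (p Y', q Y')\<close> is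
  impossible: the latter point lies in the diagram of \<open>M Y'\<close>, which is down-closed. All choices
  depend on finitely many values of \<open>D\<close> only and are therefore locally constant.
\<close>
theorem locally_constant_stable_good:
  assumes X: "infinite X"
    and lc_D: "locally_constant_on X D"
    and D: "\<And>Y. Y \<subseteq> X \<Longrightarrow> infinite Y \<Longrightarrow> down_closed (D Y) \<and> stable (D Y)"
  shows "\<exists>Y\<subseteq>X. infinite Y \<and> D Y \<subseteq> D (drop_least Y)"
proof (rule ccontr)
  assume "\<not> ?thesis"
  then have bad: "\<not> D Y \<subseteq> D (drop_least Y)" if "Y \<subseteq> X" "infinite Y" for Y
    using that by blast
  have drop: "drop_least Y \<subseteq> X" "infinite (drop_least Y)" if "Y \<subseteq> X" "infinite Y" for Y
    using that drop_least_subset[of Y] infinite_drop_least[of Y] by auto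
  define M where "M = (\<lambda>Y. SOME M. M \<in> D Y - D (drop_least Y))"
  have M: "M Y \<in> D Y" "M Y \<notin> D (drop_least Y)" if Y: "Y \<subseteq> X" "infinite Y" for Y
  proof -
    have "\<exists>M. M \<in> D Y - D (drop_least Y)" using bad[OF Y] by blast
    from someI_ex[OF this] show "M Y \<in> D Y" "M Y \<notin> D (drop_least Y)"
      by (simp_all add: M_def)
  qed
  have lc_M: "locally_constant_on X M"
    using locally_constant_on_compose[OF locally_constant_on_Pair[OF lc_D
        locally_constant_on_drop_least[OF lc_D]], of "\<lambda>(D, D'). SOME M. M \<in> D - D'"]
    by (simp add: M_def)
  define p where "p = (\<lambda>Y. SOME x. tail_count (M (drop_least Y)) x < tail_count (M Y) x)"
  have p: "tail_count (M (drop_least Y)) (p Y) < tail_count (M Y) (p Y)"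
    if Y: "Y \<subseteq> X" "infinite Y" for Y
  proof -
    have "\<exists>x. tail_count (M (drop_least Y)) x < tail_count (M Y) x"
    proof (rule ccontr)
      assume "\<not> ?thesis"
      then have "tail_count (M Y) x \<le> tail_count (M (drop_least Y)) x" for x
        by (simp add: linorder_not_less)
      then have "M Y \<in> D (drop_least Y)"
        using stable_dominated D[OF drop[OF Y]] M(1)[OF drop[OF Y]] by blast
      then show False using M(2)[OF Y] by blast
    qed
    then show ?thesis unfolding p_def by (rule someI_ex)
  qed
  have lc_p: "locally_constant_on X p"
    using locally_constant_on_compose[OF locally_constant_on_Pair[OF lc_M
        locally_constant_on_drop_least[OF lc_M]],
        of "\<lambda>(M, M'). SOME x. tail_count M' x < tail_count M x"]
    by (simp add: p_def)
  \<comment> \<open>The least height that misses the diagram of \<open>M (drop_least Y)\<close> in column \<open>p Y\<close>.\<close>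
  define q where "q = (\<lambda>Y. tail_count (M (drop_least Y)) (p Y))"
  obtain Y where Y: "Y \<subseteq> X" "infinite Y" "p Y \<le> p (drop_least Y)" "q Y \<le> q (drop_least Y)"
    using locally_constant_nat_pair_good[OF X lc_p] by blast
  let ?Y' = "drop_least Y"
  have "q ?Y' < tail_count (M ?Y') (p ?Y')"
    using p[OF drop[OF Y(1,2)]] by (simp add: q_def)
  also have "\<dots> \<le> q Y"
    using Y(3) by (simp add: q_def tail_count_antimono)
  finally show False using Y(4) by simp
qed

theorem proposition6p5: "nash_williams Hilb"
  unfolding nash_williams_def
proof (intro allI impI ballI)
  fix B f
  assume "barrier B" and f: "f \<in> B \<rightarrow> Hilb"
  then obtain X where B: "barrier_on X B" by (auto simp: barrier_def)
  have "\<forall>b\<in>B. \<exists>E n. E \<subseteq> {M. set_mset M \<subseteq> {..<n}} \<and> down_closed E \<and> stable E \<and>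
      hilbert_function E = f b"
  proof
    fix b assume "b \<in> B"
    then have "f b \<in> Hilb" using f by blast
    then show "\<exists>E n. E \<subseteq> {M. set_mset M \<subseteq> {..<n}} \<and> down_closed E \<and> stable E \<and>
        hilbert_function E = f b"
      by (rule Hilb_stable_representative) blast
  qed
  then obtain ideal bound where ideal: "\<forall>b\<in>B. ideal b \<subseteq> {M. set_mset M \<subseteq> {..<bound b}} \<and>
      down_closed (ideal b) \<and> stable (ideal b) \<and> hilbert_function (ideal b) = f b"
    by metis
  define D where "D = (\<lambda>Y. ideal (barrier_segment B Y))"
  have "infinite X" using B by (simp add: barrier_on_def)
  moreover have "locally_constant_on X D"
    unfolding D_def
    by (rule locally_constant_on_compose[OF locally_constant_on_barrier_segment[OF B]])
  moreover have "down_closed (D Y) \<and> stable (D Y)" if "Y \<subseteq> X" "infinite Y" for Y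
    using ideal barrier_segment(1)[OF B that] by (simp add: D_def)
  ultimately obtain Y where Y: "Y \<subseteq> X" "infinite Y" "D Y \<subseteq> D (drop_least Y)"
    using locally_constant_stable_good[of X D] by blast
  let ?b = "barrier_segment B Y" and ?b' = "barrier_segment B (drop_least Y)"
  have "drop_least Y \<subseteq> X" "infinite (drop_least Y)"
    using Y(1,2) drop_least_subset[of Y] infinite_drop_least[of Y] by auto
  then have b: "?b \<in> B" "?b' \<in> B"
    using barrier_segment(1)[OF B] Y(1,2) by simp_all
  have "hilbert_function (D Y) \<le> hilbert_function (D (drop_least Y))"
    using hilbert_function_mono[OF _ finite_lessThan Y(3), of "bound ?b'"] ideal b(2)
    by (simp add: D_def)
  then have "f ?b \<le> f ?b'"
    using ideal b by (simp add: D_def)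
  then show "\<exists>b\<^sub>1\<in>B. \<exists>b\<^sub>2\<in>B. shift_rel b\<^sub>1 b\<^sub>2 \<and> f b\<^sub>1 \<le> f b\<^sub>2"
    using b shift_rel_barrier_segment[OF B Y(1,2)] by blast
qed

end
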